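(* Let $n\ge2$, $\tau\in\{1,\dots,n\}$, and let $f_1,\dots,f_n:\mathbb{R}^d\to\mathbb{R}$ be differentiable and convex. Suppose there is $x_\star\in\mathbb{R}^d$ with $\nabla f_i(x_\star)=0$ for all $i$ (interpolation regime). Let $\gamma>0$, let $L_\gamma$ be the smoothness constant of $M^\gamma=\frac1n\sum_{i=1}^n M^\gamma_{f_i}$, and let $$L_{\gamma,\tau}=\frac{n-\tau}{\tau(n-1)}\cdot\frac1\gamma+\frac{n(\tau-1)}{\tau(n-1)}\cdot L_\gamma.$$ Run FedExProx with $\tau$-nice sampling, step size $\gamma$ and constant extrapolation parameter $\alpha_k=\alpha$ satisfying $0<\alpha<\frac{2}{\gamma L_{\gamma,\tau}}$ from $x_0\in\mathbb{R}^d$ for $K\ge1$ iterations. Then $$\mathbb{E}\left[\gamma M^\gamma(\bar x_K)\right]-\inf\gamma M^\gamma\le\frac{1}{\alpha(2-\alpha\gamma L_{\gamma,\tau})}\cdot\frac{\|x_0-x_\star\|^2}{K},$$ where $\bar x_K$ is chosen uniformly from the first $K$ iterates $\{x_0,\dots,x_{K-1}\}$. The best $\alpha$ (minimizing the right-hand side) is $\alpha_\star=\frac{1}{\gamma L_{\gamma,\tau}}\ge1$, and the corresponding convergence is $$\mathbb{E}\left[\gamma M^\gamma(\bar x_K)\right]-\inf\gamma M^\gamma\le\left(\frac{n-\tau}{\tau(n-1)}+\frac{n(\tau-1)}{\tau(n-1)}\gamma L_\gamma\right)\cdot\frac{\|x_0-x_\star\|^2}{K}.$$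
   Context: $\|\cdot\|$ is the Euclidean norm. A differentiable $\phi:\mathbb{R}^d\to\mathbb{R}$ is $L$-smooth if $\phi(x)-\phi(y)-\langle\nabla\phi(y),x-y\rangle\le\frac L2\|x-y\|^2$ for all $x,y$. Proximity operator: $\mathrm{prox}_{\gamma\phi}(x)=\arg\min_{z}\{\phi(z)+\frac1{2\gamma}\|z-x\|^2\}$. Moreau envelope: $M^\gamma_\phi(x)=\min_z\{\phi(z)+\frac1{2\gamma}\|z-x\|^2\}$. Convention on $L_\gamma$: $L_\gamma>0$, $M^\gamma$ is $L_\gamma$-smooth and $L_\gamma\le\frac1\gamma$ (such a constant always exists). FedExProx with $\tau$-nice sampling: starting at $x_0$, at each iteration $k$ a set $S_k\subseteq\{1,\dots,n\}$ is sampled uniformly at random (independently of the past) among all subsets of cardinality $\tau$, and $x_{k+1}=x_k+\alpha_k\left(\frac1\tau\sum_{i\in S_k}\mathrm{prox}_{\gamma f_i}(x_k)-x_k\right)$. The expectation is over all the randomness. *)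

theory Defs
  imports "HOL-Analysis.Analysis" "HOL-Probability.Product_PMF"
begin

definition grad :: "('a::euclidean_space \<Rightarrow> real) \<Rightarrow> 'a \<Rightarrow> 'a" where
  "grad \<phi> x = (THE g. GDERIV \<phi> x :> g)"

definition L_smooth :: "real \<Rightarrow> ('a::euclidean_space \<Rightarrow> real) \<Rightarrow> bool" where
  "L_smooth L \<phi> \<longleftrightarrow>
     (\<forall>x. \<phi> differentiable (at x)) \<and>
     (\<forall>x y. \<phi> x - \<phi> y - grad \<phi> y \<bullet> (x - y) \<le> L / 2 * (norm (x - y))\<^sup>2)"

text \<open>
  For convex \<open>\<phi>\<close> and \<open>\<gamma> > 0\<close> the minimizer exists and is unique, so the choice made by
  \<^const>\<open>arg_min\<close> is immaterial and the infimum in \<open>moreau\<close> is attained.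
\<close>

definition prox :: "real \<Rightarrow> ('a::euclidean_space \<Rightarrow> real) \<Rightarrow> 'a \<Rightarrow> 'a" where
  "prox \<gamma> \<phi> x = arg_min (\<lambda>z. \<phi> z + 1 / (2 * \<gamma>) * (norm (z - x))\<^sup>2) (\<lambda>z. True)"

definition moreau :: "real \<Rightarrow> ('a::euclidean_space \<Rightarrow> real) \<Rightarrow> 'a \<Rightarrow> real" where
  "moreau \<gamma> \<phi> x = (INF z. \<phi> z + 1 / (2 * \<gamma>) * (norm (z - x))\<^sup>2)"

definition avg_moreau ::
    "nat \<Rightarrow> real \<Rightarrow> (nat \<Rightarrow> 'a::euclidean_space \<Rightarrow> real) \<Rightarrow> 'a \<Rightarrow> real" where
  "avg_moreau n \<gamma> f x = 1 / real n * (\<Sum>i\<in>{1..n}. moreau \<gamma> (f i) x)"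

definition L_nice :: "nat \<Rightarrow> nat \<Rightarrow> real \<Rightarrow> real \<Rightarrow> real" where
  "L_nice n \<tau> \<gamma> L =
     (real n - real \<tau>) / (real \<tau> * (real n - 1)) * (1 / \<gamma>)
     + real n * (real \<tau> - 1) / (real \<tau> * (real n - 1)) * L"

text \<open>The iterates along a given sequence \<open>S\<close> of sampled sets.\<close>

primrec fedexprox ::
    "nat \<Rightarrow> real \<Rightarrow> (nat \<Rightarrow> 'a::euclidean_space \<Rightarrow> real) \<Rightarrow> (nat \<Rightarrow> real) \<Rightarrow> 'a \<Rightarrow>
     (nat \<Rightarrow> nat set) \<Rightarrow> nat \<Rightarrow> 'a" where
  "fedexprox \<tau> \<gamma> f \<alpha> x0 S 0 = x0"
| "fedexprox \<tau> \<gamma> f \<alpha> x0 S (Suc k) =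
     (let x = fedexprox \<tau> \<gamma> f \<alpha> x0 S k
      in x + \<alpha> k *\<^sub>R ((1 / real \<tau>) *\<^sub>R (\<Sum>i\<in>S k. prox \<gamma> (f i) x) - x))"

definition nice_sampling :: "nat \<Rightarrow> nat \<Rightarrow> nat set pmf" where
  "nice_sampling n \<tau> = pmf_of_set {A. A \<subseteq> {1..n} \<and> card A = \<tau>}"

text \<open>
  The law of the iterate with an index drawn uniformly from \<open>{0, \<dots>, K - 1}\<close>, independently of the
  sampled sets \<open>S 0, \<dots>, S (K - 1)\<close>, which are mutually independent (the second argument of
  \<^const>\<open>Pi_pmf\<close> is only the irrelevant value of \<open>S k\<close> for \<open>k \<ge> K\<close>).
\<close>

definition fedexprox_avg ::
    "nat \<Rightarrow> nat \<Rightarrow> real \<Rightarrow> (nat \<Rightarrow> 'a::euclidean_space \<Rightarrow> real) \<Rightarrow> (nat \<Rightarrow> real) \<Rightarrow> 'a \<Rightarrow>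
     nat \<Rightarrow> 'a pmf" where
  "fedexprox_avg n \<tau> \<gamma> f \<alpha> x0 K =
     map_pmf (\<lambda>(k, S). fedexprox \<tau> \<gamma> f \<alpha> x0 S k)
       (pair_pmf (pmf_of_set {..<K}) (Pi_pmf {..<K} {} (\<lambda>_. nice_sampling n \<tau>)))"

end

theory Submission
  imports Defs
begin

text \<open>
  FedExProx is stochastic gradient descent on \<open>M\<close> with step \<open>\<alpha>\<gamma>\<close>, because
  \<open>G i x = (x - prox \<gamma> (f i) x) / \<gamma>\<close> is the gradient of the Moreau envelope of \<open>f i\<close>.
  The sampled gradient has second moment \<open>V = a A + b B\<close>, where \<open>A\<close> is the mean of \<open>\<parallel>G i x\<parallel>\<^sup>2\<close>,
  \<open>B = \<parallel>\<nabla>M x\<parallel>\<^sup>2\<close>, \<open>a + b = 1\<close> and \<open>L_nice = a / \<gamma> + b L\<gamma>\<close>. Each envelope is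
  \<open>1 / \<gamma>\<close>-smooth and \<open>M\<close> is \<open>L\<gamma>\<close>-smooth, with common minimizer \<open>xs\<close>. Weighting the
  corresponding descent and cocoercivity inequalities by \<open>a / \<gamma>\<close> and \<open>b L\<gamma>\<close> gives, for the gap \<open>D = M x - M xs\<close>,
  \<open>V \<le> 2 L_nice D\<close> and \<open>\<nabla>M x \<bullet> (x - xs) \<ge> D + V / (2 L_nice)\<close>. Hence each step decreases
  the expected \<open>\<parallel>x - xs\<parallel>\<^sup>2\<close> by at least \<open>\<alpha> (2 - \<alpha> \<gamma> L_nice) \<gamma> D\<close>, and the sum telescopes.
\<close>

subsection \<open>Gradients\<close>

text \<open>Riesz representation supplies the vector, as the adjoint of the derivative applied to 1;
  uniqueness of derivatives makes the \<open>THE\<close> in \<open>grad\<close> well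
  defined.\<close>

lemma GDERIV_grad:
  fixes \<phi> :: "'a::euclidean_space \<Rightarrow> real"
  assumes "\<phi> differentiable (at x)"
  shows "GDERIV \<phi> x :> grad \<phi> x"
proof -
  obtain \<phi>' where \<phi>': "(\<phi> has_derivative \<phi>') (at x)"
    using assms by (auto simp: differentiable_def)
  have "\<phi>' = (\<lambda>h. h \<bullet> adjoint \<phi>' 1)"
    using adjoint_works[OF has_derivative_linear[OF \<phi>']] by fastforce
  with \<phi>' have ex: "GDERIV \<phi> x :> adjoint \<phi>' 1"
    unfolding gderiv_def by metis
  have "a = b" if "GDERIV \<phi> x :> a" "GDERIV \<phi> x :> b" for a b
  proof -
    have "(\<lambda>h. h \<bullet> a) = (\<lambda>h. h \<bullet> b)"
      using that unfolding gderiv_def by (rule has_derivative_unique)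
    then have "(a - b) \<bullet> (a - b) = 0"
      by (metis inner_diff_right right_minus_eq)
    then show ?thesis by simp
  qed
  then have "\<exists>!g. GDERIV \<phi> x :> g"
    using ex by blast
  then show ?thesis
    unfolding grad_def by (rule theI')
qed

text \<open>
  This identifies the gradient of the averaged envelope without differentiating the
  individual envelopes.
\<close>

lemma grad_eq_of_quadratic_majorant:
  fixes \<phi> :: "'a::euclidean_space \<Rightarrow> real"
  assumes "\<phi> differentiable (at x)"
    and major: "\<And>y. \<phi> y \<le> \<phi> x + g \<bullet> (y - x) + c * (norm (y - x))\<^sup>2"
  shows "grad \<phi> x = g"
proof -
  \<comment> \<open>\<open>?r\<close>, majorant minus function, is nonnegative and vanishes at
    \<open>x\<close>. So \<open>x\<close> minimizes it and its derivative there is zero.\<close>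
  let ?r = "\<lambda>y. \<phi> x + g \<bullet> (y - x) + c * ((y - x) \<bullet> (y - x)) - \<phi> y"
  have "(\<phi> has_derivative (\<lambda>h. h \<bullet> grad \<phi> x)) (at x)"
    using GDERIV_grad[OF assms(1)] by (simp add: gderiv_def)
  then have "(?r has_derivative (\<lambda>h. g \<bullet> h - h \<bullet> grad \<phi> x)) (at x)"
    by (auto intro!: derivative_eq_intros)
  moreover have "?r x \<le> ?r y" for y
    using major[of y] by (simp add: power2_norm_eq_inner)
  ultimately have "(\<lambda>h. g \<bullet> h - h \<bullet> grad \<phi> x) = (\<lambda>h. 0)"
    by (intro has_derivative_local_min[of ?r _ x] always_eventually) auto
  \<comment> \<open>The vanishing derivative is evaluated in the direction
    \<open>g - grad \<phi> x\<close>.\<close>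
  then have "g \<bullet> (g - grad \<phi> x) - (g - grad \<phi> x) \<bullet> grad \<phi> x = 0"
    by meson
  then have "(g - grad \<phi> x) \<bullet> (g - grad \<phi> x) = 0"
    by (simp add: inner_diff_left inner_diff_right inner_commute)
  then show ?thesis by simp
qed

text \<open>Along the segment to \<open>z\<close>, convexity bounds the difference quotient at
  \<open>x\<close> by \<open>\<phi> z - \<phi> x\<close>, while the quotient tends to the
  directional derivative 0.\<close>

lemma convex_grad_zero_imp_min:
  fixes \<phi> :: "'a::euclidean_space \<Rightarrow> real"
  assumes "\<phi> differentiable (at x)" "convex_on UNIV \<phi>" "grad \<phi> x = 0"
  shows "\<phi> x \<le> \<phi> z"
proof -
  have D: "(\<phi> has_derivative (\<lambda>h. 0)) (at x)"
    using GDERIV_grad[OF assms(1)] assms(3) by (simp add: gderiv_def)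
  let ?q = "\<lambda>t::real. x + t *\<^sub>R (z - x)"
  have "(?q has_derivative (\<lambda>t. t *\<^sub>R (z - x))) (at 0)"
    by (auto intro!: derivative_eq_intros)
  from has_derivative_compose[OF this, of \<phi> "\<lambda>h. 0"] D
  have "((\<lambda>t. \<phi> (?q t)) has_real_derivative 0) (at 0)"
    by (simp add: has_field_derivative_def lambda_zero)
  then have lim: "((\<lambda>t. (\<phi> (?q t) - \<phi> x) / t) \<longlongrightarrow> 0) (at_right 0)"
    by (auto simp: has_field_derivative_iff intro: filterlim_mono[OF _ order_refl at_le])
  have "(\<phi> (?q t) - \<phi> x) / t \<le> \<phi> z - \<phi> x" if "0 < t" "t < 1" for t
  proof -
    have "?q t = (1 - t) *\<^sub>R x + t *\<^sub>R z"
      by (simp add: algebra_simps)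
    then have "\<phi> (?q t) \<le> (1 - t) * \<phi> x + t * \<phi> z"
      using convex_onD[OF assms(2), of t x z] that by simp
    then show ?thesis
      using that by (simp add: field_simps)
  qed
  then have "\<forall>\<^sub>F t in at_right 0. (\<phi> (?q t) - \<phi> x) / t \<le> \<phi> z - \<phi> x"
    by (auto simp: eventually_at_right_field intro: exI[of _ 1])
  with lim have "0 \<le> \<phi> z - \<phi> x"
    using tendsto_upperbound trivial_limit_at_right_real by blast
  then show ?thesis by simp
qed

subsection \<open>Proximity operator and Moreau envelope\<close>

text \<open>As \<phi> is bounded below, the quadratic term makes every point outside a large ball no
  better than \<open>x\<close>; compactness of the ball then yields a minimizer.\<close>

lemma prox_minimizes:
  fixes \<phi> :: "'a::euclidean_space \<Rightarrow> real"
  assumes "continuous_on UNIV \<phi>" and lower: "\<And>z. m \<le> \<phi> z" and "\<gamma> > 0"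
  shows "\<phi> (prox \<gamma> \<phi> x) + 1 / (2 * \<gamma>) * (norm (prox \<gamma> \<phi> x - x))\<^sup>2
           \<le> \<phi> z + 1 / (2 * \<gamma>) * (norm (z - x))\<^sup>2"
proof -
  let ?h = "\<lambda>z. \<phi> z + 1 / (2 * \<gamma>) * (norm (z - x))\<^sup>2"
  \<comment> \<open>Outside the ball the squared distance is at least \<open>R\<close>, because
    \<open>R \<ge> 1\<close> (hence the summand 1). The penalty is then at least
    \<open>\<phi> x - m\<close>.\<close>
  define R where "R = 1 + 2 * \<gamma> * (\<phi> x - m)"
  have R: "R \<ge> 1"
    using lower[of x] \<open>\<gamma> > 0\<close> by (simp add: R_def)
  have "continuous_on (cball x R) ?h"
    using assms(1) by (intro continuous_intros) (auto intro: continuous_on_subset)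
  then have "\<exists>p\<in>cball x R. \<forall>z\<in>cball x R. ?h p \<le> ?h z"
    using R by (intro continuous_attains_inf) auto
  then obtain p where p: "\<And>z. z \<in> cball x R \<Longrightarrow> ?h p \<le> ?h z"
    by blast
  have min: "?h p \<le> ?h z" for z
  proof (cases "z \<in> cball x R")
    case False
    then have "R < norm (z - x)"
      by (simp add: dist_norm norm_minus_commute)
    with R have "R * 1 \<le> norm (z - x) * norm (z - x)"
      by (intro mult_mono) auto
    then have "2 * \<gamma> * (\<phi> x - m) \<le> (norm (z - x))\<^sup>2"
      by (simp add: R_def power2_eq_square)
    then have "\<phi> x - m \<le> 1 / (2 * \<gamma>) * (norm (z - x))\<^sup>2"
      using \<open>\<gamma> > 0\<close> by (simp add: field_simps)
    then have "?h x \<le> ?h z"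
      using lower[of z] by simp
    moreover have "?h p \<le> ?h x"
      using p[of x] R by simp
    ultimately show ?thesis by linarith
  qed (rule p)
  \<comment> \<open>\<open>arg_min\<close> picks some minimizer, and all minimizers share one
    value.\<close>
  have "?h (prox \<gamma> \<phi> x) = ?h p"
    unfolding prox_def by (rule arg_min_equality) (rule TrueI, rule min)
  then show ?thesis
    using min[of z] by linarith
qed

lemma moreau_le:
  assumes lower: "\<And>z. m \<le> \<phi> z" and "\<gamma> > 0"
  shows "moreau \<gamma> \<phi> x \<le> \<phi> z + 1 / (2 * \<gamma>) * (norm (z - x))\<^sup>2"
  unfolding moreau_def
proof (rule cINF_lower)
  show "bdd_below (range (\<lambda>z. \<phi> z + 1 / (2 * \<gamma>) * (norm (z - x))\<^sup>2))"
    using assms by (auto intro!: bdd_belowI[of _ m] add_increasing2)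
qed simp

lemma moreau_eq_prox:
  fixes \<phi> :: "'a::euclidean_space \<Rightarrow> real"
  assumes "continuous_on UNIV \<phi>" "\<And>z. m \<le> \<phi> z" "\<gamma> > 0"
  shows "moreau \<gamma> \<phi> x = \<phi> (prox \<gamma> \<phi> x) + 1 / (2 * \<gamma>) * (norm (prox \<gamma> \<phi> x - x))\<^sup>2"
proof (rule antisym)
  show "moreau \<gamma> \<phi> x \<le> \<phi> (prox \<gamma> \<phi> x) + 1 / (2 * \<gamma>) * (norm (prox \<gamma> \<phi> x - x))\<^sup>2"
    using assms(2,3) by (rule moreau_le)
  show "\<phi> (prox \<gamma> \<phi> x) + 1 / (2 * \<gamma>) * (norm (prox \<gamma> \<phi> x - x))\<^sup>2 \<le> moreau \<gamma> \<phi> x"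
    unfolding moreau_def
    using prox_minimizes[OF assms] by (intro cINF_greatest) auto
qed

text \<open>The prox point of \<open>x\<close> is a competitor in the infimum at \<open>y\<close>;
  expanding its squared distance to \<open>y\<close> around \<open>x\<close> leaves the linear and
  the quadratic term.\<close>

lemma moreau_majorant:
  fixes \<phi> :: "'a::euclidean_space \<Rightarrow> real"
  assumes "continuous_on UNIV \<phi>" "\<And>z. m \<le> \<phi> z" "\<gamma> > 0"
  shows "moreau \<gamma> \<phi> y \<le> moreau \<gamma> \<phi> x + ((x - prox \<gamma> \<phi> x) /\<^sub>R \<gamma>) \<bullet> (y - x)
           + 1 / (2 * \<gamma>) * (norm (y - x))\<^sup>2"
proof -
  define p where "p = prox \<gamma> \<phi> x"
  have "(norm (p - y))\<^sup>2 = (norm (p - x))\<^sup>2 + 2 * ((x - p) \<bullet> (y - x)) + (norm (y - x))\<^sup>2"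
    by (simp add: power2_norm_eq_inner algebra_simps inner_commute)
  then have "1 / (2 * \<gamma>) * (norm (p - y))\<^sup>2 = 1 / (2 * \<gamma>) * (norm (p - x))\<^sup>2
      + ((x - p) /\<^sub>R \<gamma>) \<bullet> (y - x) + 1 / (2 * \<gamma>) * (norm (y - x))\<^sup>2"
    by (simp add: add_divide_distrib inverse_eq_divide)
  then show ?thesis
    using moreau_le[of m \<phi> \<gamma> y p, OF assms(2,3)] moreau_eq_prox[OF assms, of x]
    by (simp add: p_def)
qed

text \<open>First-order optimality of the prox point \<open>p\<close>: compare it with points at
  fraction \<open>t\<close> of the way to \<open>z\<close>, divide by \<open>t\<close> and let
  \<open>t\<close> tend to 0. Only the first-order part \<open>a\<close> survives.\<close>

lemma prox_subgradient:
  fixes \<phi> :: "'a::euclidean_space \<Rightarrow> real"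
  assumes "convex_on UNIV \<phi>" "continuous_on UNIV \<phi>" "\<And>z. m \<le> \<phi> z" "\<gamma> > 0"
  shows "\<phi> z \<ge> \<phi> (prox \<gamma> \<phi> x) + ((x - prox \<gamma> \<phi> x) /\<^sub>R \<gamma>) \<bullet> (z - prox \<gamma> \<phi> x)"
proof -
  define p where "p = prox \<gamma> \<phi> x"
  define a where "a = \<phi> z - \<phi> p - ((x - p) /\<^sub>R \<gamma>) \<bullet> (z - p)"
  define b where "b = 1 / (2 * \<gamma>) * (norm (z - p))\<^sup>2"
  have "0 \<le> a + t * b" if "0 < t" "t < 1" for t
  proof -
    have "p + t *\<^sub>R (z - p) = (1 - t) *\<^sub>R p + t *\<^sub>R z"
      by (simp add: algebra_simps)
    then have "\<phi> (p + t *\<^sub>R (z - p)) \<le> (1 - t) * \<phi> p + t * \<phi> z"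
      using convex_onD[OF assms(1), of t p z] that by simp
    moreover have "(norm (p + t *\<^sub>R (z - p) - x))\<^sup>2
        = (norm (p - x))\<^sup>2 - 2 * t * ((x - p) \<bullet> (z - p)) + t\<^sup>2 * (norm (z - p))\<^sup>2"
      unfolding power2_norm_eq_inner by (simp add: power2_eq_square algebra_simps inner_commute)
    then have "1 / (2 * \<gamma>) * (norm (p + t *\<^sub>R (z - p) - x))\<^sup>2
        = 1 / (2 * \<gamma>) * (norm (p - x))\<^sup>2 - t * (((x - p) /\<^sub>R \<gamma>) \<bullet> (z - p)) + t\<^sup>2 * b"
      by (simp add: b_def add_divide_distrib diff_divide_distrib inverse_eq_divide)
    moreover have "\<phi> p + 1 / (2 * \<gamma>) * (norm (p - x))\<^sup>2
        \<le> \<phi> (p + t *\<^sub>R (z - p)) + 1 / (2 * \<gamma>) * (norm (p + t *\<^sub>R (z - p) - x))\<^sup>2"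
      unfolding p_def using assms(2-4) by (rule prox_minimizes)
    ultimately have "0 \<le> t * (a + t * b)"
      by (simp add: a_def algebra_simps power2_eq_square)
    then show ?thesis
      using \<open>0 < t\<close> by (simp add: zero_le_mult_iff)
  qed
  then have "\<forall>\<^sub>F t in at_right 0. 0 \<le> a + t * b"
    by (auto simp: eventually_at_right_field intro: exI[of _ 1])
  moreover have "((\<lambda>t. a + t * b) \<longlongrightarrow> a + 0 * b) (at_right 0)"
    by (intro tendsto_intros)
  ultimately have "0 \<le> a"
    using tendsto_lowerbound[of "\<lambda>t. a + t * b" "a + 0 * b" "at_right 0" 0] by simp
  then show ?thesis
    by (simp add: a_def p_def)
qed

text \<open>For each competitor \<open>z\<close> at \<open>y\<close>, the subgradient inequality of
  \<phi> at the prox point of \<open>x\<close> and one nonnegative square give the bound; then the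
  infimum over \<open>z\<close> is taken.\<close>

lemma moreau_subgradient:
  fixes \<phi> :: "'a::euclidean_space \<Rightarrow> real"
  assumes "convex_on UNIV \<phi>" "continuous_on UNIV \<phi>" "\<And>z. m \<le> \<phi> z" "\<gamma> > 0"
  shows "moreau \<gamma> \<phi> y \<ge> moreau \<gamma> \<phi> x + ((x - prox \<gamma> \<phi> x) /\<^sub>R \<gamma>) \<bullet> (y - x)"
proof -
  define p where "p = prox \<gamma> \<phi> x"
  have le: "moreau \<gamma> \<phi> x + ((x - p) /\<^sub>R \<gamma>) \<bullet> (y - x) \<le> \<phi> z + 1 / (2 * \<gamma>) * (norm (z - y))\<^sup>2" for z
  proof -
    \<comment> \<open>The expansion of this square is exactly the slack that remains once
      \<open>\<phi> z\<close> is replaced by its lower bound from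
      \<open>prox_subgradient\<close>.\<close>
    have "0 \<le> 1 / (2 * \<gamma>) * (norm ((z - y) + (x - p)))\<^sup>2"
      using \<open>\<gamma> > 0\<close> by simp
    also have "(norm ((z - y) + (x - p)))\<^sup>2
        = 2 * ((x - p) \<bullet> (z - p)) - 2 * ((x - p) \<bullet> (y - x)) + (norm (z - y))\<^sup>2 - (norm (p - x))\<^sup>2"
      by (simp add: power2_norm_eq_inner algebra_simps inner_commute)
    also have "1 / (2 * \<gamma>) * \<dots> = ((x - p) /\<^sub>R \<gamma>) \<bullet> (z - p) - ((x - p) /\<^sub>R \<gamma>) \<bullet> (y - x)
        + 1 / (2 * \<gamma>) * (norm (z - y))\<^sup>2 - 1 / (2 * \<gamma>) * (norm (p - x))\<^sup>2"
      by (simp add: add_divide_distrib diff_divide_distrib inverse_eq_divide)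
    finally show ?thesis
      using prox_subgradient[OF assms, of x z] moreau_eq_prox[OF assms(2-4), of x]
      by (simp add: p_def)
  qed
  have "moreau \<gamma> \<phi> x + ((x - p) /\<^sub>R \<gamma>) \<bullet> (y - x) \<le> moreau \<gamma> \<phi> y"
    unfolding moreau_def[of \<gamma> \<phi> y] by (rule cINF_greatest[OF UNIV_not_empty le])
  then show ?thesis
    by (simp only: p_def)
qed

subsection \<open>Smooth convex inequalities\<close>

text \<open>The gradient step \<open>x - g /\<^sub>R L\<close> minimizes the quadratic majorant; the
  majorant's value there cannot lie below the minimum of \<phi>.\<close>

lemma norm_gradient_le_gap:
  fixes \<phi> :: "'a::real_inner \<Rightarrow> real"
  assumes "L > 0" and major: "\<And>y. \<phi> y \<le> \<phi> x + g \<bullet> (y - x) + L / 2 * (norm (y - x))\<^sup>2"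
    and min: "\<And>y. \<phi> xs \<le> \<phi> y"
  shows "(norm g)\<^sup>2 \<le> 2 * L * (\<phi> x - \<phi> xs)"
proof -
  have eqs: "norm (g /\<^sub>R L) = norm g / L" "g \<bullet> (g /\<^sub>R L) = (norm g)\<^sup>2 / L"
    using \<open>L > 0\<close> by (simp_all add: power2_norm_eq_inner divide_inverse_commute)
  have "\<phi> xs \<le> \<phi> (x - g /\<^sub>R L)"
    by (rule min)
  also have "\<dots> \<le> \<phi> x - (norm g)\<^sup>2 / L + L / 2 * (norm g / L)\<^sup>2"
    using major[of "x - g /\<^sub>R L"] by (simp add: eqs del: norm_scaleR inner_scaleR_right)
  also have "\<dots> = \<phi> x - (norm g)\<^sup>2 / (2 * L)"
    using \<open>L > 0\<close> by (simp add: field_simps power2_eq_square)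
  finally show ?thesis
    using \<open>L > 0\<close> by (simp add: field_simps)
qed

text \<open>At the point \<open>xs + g /\<^sub>R L\<close> the affine minorant taken at
  \<open>x\<close> is compared with the quadratic majorant taken at \<open>xs\<close>. The latter
  has no linear term since in the applications \<open>xs\<close> is a minimizer.\<close>

lemma cocoercive_at_min:
  fixes \<phi> :: "'a::real_inner \<Rightarrow> real"
  assumes "L > 0" and major: "\<And>y. \<phi> y \<le> \<phi> xs + L / 2 * (norm (y - xs))\<^sup>2"
    and minor: "\<And>y. \<phi> x + g \<bullet> (y - x) \<le> \<phi> y"
  shows "g \<bullet> (x - xs) \<ge> \<phi> x - \<phi> xs + (norm g)\<^sup>2 / (2 * L)"
proof -
  have eqs: "norm (g /\<^sub>R L) = norm g / L" "g \<bullet> (g /\<^sub>R L) = (norm g)\<^sup>2 / L"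
    using \<open>L > 0\<close> by (simp_all add: power2_norm_eq_inner divide_inverse_commute)
  have "\<phi> x + g \<bullet> (xs - x) + (norm g)\<^sup>2 / L = \<phi> x + g \<bullet> (xs + g /\<^sub>R L - x)"
    by (simp add: inner_diff_right inner_add_right eqs del: inner_scaleR_right)
  also have "\<dots> \<le> \<phi> (xs + g /\<^sub>R L)"
    by (rule minor)
  also have "\<dots> \<le> \<phi> xs + L / 2 * (norm g / L)\<^sup>2"
    using major[of "xs + g /\<^sub>R L"] by (simp add: eqs del: norm_scaleR)
  also have "\<dots> = \<phi> xs + (norm g)\<^sup>2 / L - (norm g)\<^sup>2 / (2 * L)"
    using \<open>L > 0\<close> by (simp add: field_simps power2_eq_square)
  finally show ?thesis
    by (simp add: inner_diff_right)
qed

subsection \<open>Sampling\<close>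

text \<open>Removing \<open>T\<close> is a bijection onto the subsets of \<open>A - T\<close> of
  size \<open>k - card T\<close>.\<close>

lemma card_subsets_containing:
  assumes "finite A" "T \<subseteq> A" "card T \<le> k"
  shows "card {S. S \<subseteq> A \<and> card S = k \<and> T \<subseteq> S} = (card A - card T) choose (k - card T)"
proof -
  have T: "finite T"
    using assms finite_subset by blast
  have fin: "finite S" if "S \<subseteq> A" for S
    using that assms(1) finite_subset by blast
  have "bij_betw (\<lambda>S. S - T) {S. S \<subseteq> A \<and> card S = k \<and> T \<subseteq> S}
      {S. S \<subseteq> A - T \<and> card S = k - card T}"
  proof (rule bij_betwI[where g = "\<lambda>S. S \<union> T"])
    show "(\<lambda>S. S - T) \<in> {S. S \<subseteq> A \<and> card S = k \<and> T \<subseteq> S} \<rightarrow> {S. S \<subseteq> A - T \<and> card S = k - card T}"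
      using T by (auto simp: card_Diff_subset)
    show "(\<lambda>S. S \<union> T) \<in> {S. S \<subseteq> A - T \<and> card S = k - card T} \<rightarrow> {S. S \<subseteq> A \<and> card S = k \<and> T \<subseteq> S}"
    proof
      fix S assume "S \<in> {S. S \<subseteq> A - T \<and> card S = k - card T}"
      moreover from this have "card (S \<union> T) = card S + card T"
        using T fin by (intro card_Un_disjoint) auto
      ultimately show "S \<union> T \<in> {S. S \<subseteq> A \<and> card S = k \<and> T \<subseteq> S}"
        using assms by auto
    qed
  qed auto
  then have "card {S. S \<subseteq> A \<and> card S = k \<and> T \<subseteq> S} = card {S. S \<subseteq> A - T \<and> card S = k - card T}"
    by (rule bij_betw_same_card)
  then show ?thesis
    using assms T by (simp add: n_subsets card_Diff_subset)
qed

context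
  fixes n \<tau> :: nat
  assumes \<tau>: "\<tau> \<in> {1..n}"
begin

lemma card_nice_subsets: "card {A. A \<subseteq> {1..n} \<and> card A = \<tau>} = n choose \<tau>"
  using n_subsets[of "{1..n}" \<tau>] by simp

lemma nice_subsets_finite_nonempty:
  "finite {A. A \<subseteq> {1..n} \<and> card A = \<tau>}" "{A. A \<subseteq> {1..n} \<and> card A = \<tau>} \<noteq> {}"
proof -
  show "finite {A. A \<subseteq> {1..n} \<and> card A = \<tau>}"
    by simp
  have "card {A. A \<subseteq> {1..n} \<and> card A = \<tau>} > 0"
    unfolding card_nice_subsets using \<tau> by simp
  then show "{A. A \<subseteq> {1..n} \<and> card A = \<tau>} \<noteq> {}"
    by (metis card.empty less_irrefl)
qed

lemma set_nice_sampling: "set_pmf (nice_sampling n \<tau>) = {A. A \<subseteq> {1..n} \<and> card A = \<tau>}"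
  unfolding nice_sampling_def using nice_subsets_finite_nonempty by simp

lemma expectation_nice_sampling:
  fixes h :: "nat set \<Rightarrow> real"
  shows "measure_pmf.expectation (nice_sampling n \<tau>) h
    = (\<Sum>A | A \<subseteq> {1..n} \<and> card A = \<tau>. h A) / (n choose \<tau>)"
  unfolding nice_sampling_def
  using nice_subsets_finite_nonempty by (simp add: integral_pmf_of_set card_nice_subsets del: One_nat_def)

text \<open>The ratio of \<open>(n - 1) choose (\<tau> - 1)\<close> to
  \<open>n choose \<tau>\<close> simplifies by the absorption identity.\<close>

lemma expectation_nice_member:
  assumes "i \<in> {1..n}"
  shows "measure_pmf.expectation (nice_sampling n \<tau>) (\<lambda>A. of_bool (i \<in> A)) = real \<tau> / real n"
proof -
  have "card {A. A \<subseteq> {1..n} \<and> card A = \<tau> \<and> {i} \<subseteq> A} = (n - 1) choose (\<tau> - 1)"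
    using card_subsets_containing[of "{1..n}" "{i}" \<tau>] assms \<tau> by simp
  moreover have "(\<Sum>A | A \<subseteq> {1..n} \<and> card A = \<tau>. of_bool (i \<in> A))
      = real (card {A. A \<subseteq> {1..n} \<and> card A = \<tau> \<and> {i} \<subseteq> A})"
    by (simp add: of_bool_def sum.If_cases Int_def conj_assoc)
  moreover have "real \<tau> * real (n choose \<tau>) = real n * real ((n - 1) choose (\<tau> - 1))"
    using times_binomial_minus1_eq[of \<tau> n] \<tau> by (metis atLeastAtMost_iff of_nat_mult zero_less_one order_less_le_trans)
  ultimately show ?thesis
    using \<tau> by (simp add: expectation_nice_sampling field_simps)
qed

lemma expectation_nice_two_members:
  assumes "i \<in> {1..n}" "j \<in> {1..n}" "i \<noteq> j"
  shows "measure_pmf.expectation (nice_sampling n \<tau>) (\<lambda>A. of_bool (i \<in> A) * of_bool (j \<in> A))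
    = real \<tau> * (real \<tau> - 1) / (real n * (real n - 1))"
proof -
  have n: "n \<ge> 2"
    using assms by auto
  let ?c = "card {A. A \<subseteq> {1..n} \<and> card A = \<tau> \<and> {i, j} \<subseteq> A}"
  have sum: "(\<Sum>A | A \<subseteq> {1..n} \<and> card A = \<tau>. of_bool (i \<in> A) * of_bool (j \<in> A)) = real ?c"
    by (simp add: of_bool_def[of "_ \<and> _"] sum.If_cases Int_def conj_assoc flip: of_bool_conj)
  have "real ?c * (real n * (real n - 1)) = real \<tau> * (real \<tau> - 1) * real (n choose \<tau>)"
  \<comment> \<open>If two indices fit into a sample, the absorption identity is applied twice; for
    \<open>\<tau> = 1\<close> both sides vanish.\<close>
  proof (cases "\<tau> \<ge> 2")
    case True
    have "?c = (n - 2) choose (\<tau> - 2)"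
      using card_subsets_containing[of "{1..n}" "{i, j}" \<tau>] assms True by (simp add: numeral_2_eq_2)
    moreover have "(\<tau> - 1) * ((n - 1) choose (\<tau> - 1)) = (n - 1) * ((n - 2) choose (\<tau> - 2))"
      using times_binomial_minus1_eq[of "\<tau> - 1" "n - 1"] True by (simp add: numeral_2_eq_2)
    moreover have "\<tau> * (n choose \<tau>) = n * ((n - 1) choose (\<tau> - 1))"
      using times_binomial_minus1_eq[of \<tau> n] True by simp
    ultimately have "?c * (n * (n - 1)) = \<tau> * (\<tau> - 1) * (n choose \<tau>)"
      by (metis mult.assoc mult.commute)
    then have "real (?c * (n * (n - 1))) = real (\<tau> * (\<tau> - 1) * (n choose \<tau>))"
      by simp
    then show ?thesis
      using n True by (simp add: of_nat_diff)
  next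
    case False
    have "\<not> {i, j} \<subseteq> A" if "card A = \<tau>" "finite A" for A
      using card_mono[OF that(2), of "{i, j}"] that False assms by auto
    then have "{A. A \<subseteq> {1..n} \<and> card A = \<tau> \<and> {i, j} \<subseteq> A} = {}"
      using finite_subset[of _ "{1..n}"] by blast
    moreover have "\<tau> = 1"
      using False \<tau> by auto
    ultimately show ?thesis by simp
  qed
  then show ?thesis
    using n \<tau> unfolding expectation_nice_sampling sum by (simp add: field_simps)
qed

lemma integrable_nice_sampling:
  "integrable (measure_pmf (nice_sampling n \<tau>)) (h :: nat set \<Rightarrow> real)"
  by (rule integrable_measure_pmf_finite) (simp add: set_nice_sampling)

lemma expectation_nice_sum:
  fixes h :: "nat \<Rightarrow> real"
  shows "measure_pmf.expectation (nice_sampling n \<tau>) (\<lambda>A. \<Sum>i\<in>A. h i)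
    = real \<tau> / real n * (\<Sum>i\<in>{1..n}. h i)"
proof -
  have "measure_pmf.expectation (nice_sampling n \<tau>) (\<lambda>A. \<Sum>i\<in>A. h i)
      = measure_pmf.expectation (nice_sampling n \<tau>) (\<lambda>A. \<Sum>i\<in>{1..n}. of_bool (i \<in> A) * h i)"
  proof (intro integral_cong_AE)
    show "AE A in measure_pmf (nice_sampling n \<tau>).
        (\<Sum>i\<in>A. h i) = (\<Sum>i\<in>{1..n}. of_bool (i \<in> A) * h i)"
      by (auto simp: AE_measure_pmf_iff set_nice_sampling Int_absorb1 of_bool_def if_distrib
            simp flip: sum.inter_restrict intro!: sum.mono_neutral_cong_left)
  qed auto
  also have "\<dots> = (\<Sum>i\<in>{1..n}. measure_pmf.expectation (nice_sampling n \<tau>) (\<lambda>A. of_bool (i \<in> A)) * h i)"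
    by (subst Bochner_Integration.integral_sum) (auto intro: integrable_nice_sampling)
  finally show ?thesis
    by (simp add: expectation_nice_member sum_distrib_left del: One_nat_def atLeastAtMost_iff cong: sum.cong_simp)
qed

text \<open>Expanding the square into inner products reduces the claim to joint inclusion
  probabilities: \<open>q\<close> off the diagonal and \<open>\<tau> / n\<close> on it. The excess
  on the diagonal produces the sum of squared norms.\<close>

lemma expectation_nice_norm_sum:
  fixes v :: "nat \<Rightarrow> 'a::real_inner"
  assumes "n \<ge> 2"
  shows "measure_pmf.expectation (nice_sampling n \<tau>) (\<lambda>A. (norm (\<Sum>i\<in>A. v i))\<^sup>2)
    = real \<tau> * (real n - real \<tau>) / (real n * (real n - 1)) * (\<Sum>i\<in>{1..n}. (norm (v i))\<^sup>2)
      + real \<tau> * (real \<tau> - 1) / (real n * (real n - 1)) * (norm (\<Sum>i\<in>{1..n}. v i))\<^sup>2"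
proof -
  define q where "q = real \<tau> * (real \<tau> - 1) / (real n * (real n - 1))"
  have "measure_pmf.expectation (nice_sampling n \<tau>) (\<lambda>A. (norm (\<Sum>i\<in>A. v i))\<^sup>2)
      = measure_pmf.expectation (nice_sampling n \<tau>)
          (\<lambda>A. \<Sum>i\<in>{1..n}. \<Sum>j\<in>{1..n}. of_bool (i \<in> A) * of_bool (j \<in> A) * (v i \<bullet> v j))"
  proof (intro integral_cong_AE)
    have "(norm (\<Sum>i\<in>A. v i))\<^sup>2
        = (\<Sum>i\<in>{1..n}. \<Sum>j\<in>{1..n}. of_bool (i \<in> A) * of_bool (j \<in> A) * (v i \<bullet> v j))"
      if "A \<subseteq> {1..n}" for A
    proof -
      have "(\<Sum>i\<in>A. v i) = (\<Sum>i\<in>{1..n}. of_bool (i \<in> A) *\<^sub>R v i)"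
        using that by (intro sum.mono_neutral_cong_left) auto
      then show ?thesis
        by (simp only: power2_norm_eq_inner inner_sum_left) (simp add: inner_sum_right sum_distrib_left mult.assoc mult.left_commute del: One_nat_def sum_of_bool_mult_eq sum_mult_of_bool_eq)
    qed
    then show "AE A in measure_pmf (nice_sampling n \<tau>). (norm (\<Sum>i\<in>A. v i))\<^sup>2
        = (\<Sum>i\<in>{1..n}. \<Sum>j\<in>{1..n}. of_bool (i \<in> A) * of_bool (j \<in> A) * (v i \<bullet> v j))"
      by (auto simp: AE_measure_pmf_iff set_nice_sampling)
  qed auto
  also have "\<dots> = (\<Sum>i\<in>{1..n}. \<Sum>j\<in>{1..n}. (q + of_bool (i = j) * (real \<tau> / real n - q)) * (v i \<bullet> v j))"
  proof -
    have "measure_pmf.expectation (nice_sampling n \<tau>) (\<lambda>A. of_bool (i \<in> A) * of_bool (j \<in> A))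
        = q + of_bool (i = j) * (real \<tau> / real n - q)" if "i \<in> {1..n}" "j \<in> {1..n}" for i j
    proof (cases "i = j")
      case True
      then show ?thesis
        using expectation_nice_member[OF that(1)] by (simp flip: of_bool_conj)
    qed (use expectation_nice_two_members[OF that] in \<open>simp add: q_def\<close>)
    then show ?thesis
      by (simp only: Bochner_Integration.integral_sum integrable_nice_sampling integral_mult_left_zero
          cong: sum.cong)
  qed
  also have "\<dots> = (\<Sum>i\<in>{1..n}. q * (\<Sum>j\<in>{1..n}. v i \<bullet> v j) + (real \<tau> / real n - q) * (norm (v i))\<^sup>2)"
  proof (intro sum.cong refl)
    fix i assume i: "i \<in> {1..n}"
    have "(q + of_bool (i = j) * (real \<tau> / real n - q)) * (v i \<bullet> v j)
        = q * (v i \<bullet> v j) + (if i = j then (real \<tau> / real n - q) * (v i \<bullet> v j) else 0)" for j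
      by (cases "i = j") (simp_all add: algebra_simps)
    then show "(\<Sum>j\<in>{1..n}. (q + of_bool (i = j) * (real \<tau> / real n - q)) * (v i \<bullet> v j))
        = q * (\<Sum>j\<in>{1..n}. v i \<bullet> v j) + (real \<tau> / real n - q) * (norm (v i))\<^sup>2"
      using i by (simp add: sum.distrib sum_distrib_left power2_norm_eq_inner)
  qed
  also have "\<dots> = (real \<tau> / real n - q) * (\<Sum>i\<in>{1..n}. (norm (v i))\<^sup>2) + q * (norm (\<Sum>i\<in>{1..n}. v i))\<^sup>2"
    by (simp add: sum.distrib sum_distrib_left power2_norm_eq_inner inner_sum_left inner_sum_right
          sum_subtractf algebra_simps inner_commute)
  also have "real \<tau> / real n - q = real \<tau> * (real n - real \<tau>) / (real n * (real n - 1))"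
    using assms by (simp add: q_def divide_simps) (simp add: algebra_simps)
  finally show ?thesis
    by (simp add: q_def)
qed

end

text \<open>Fubini for finitely supported laws, used to split off one sampled set and to separate
  the random index from the sampled sets.\<close>

lemma expectation_pair_pmf_finite:
  fixes h :: "'a \<times> 'b \<Rightarrow> real"
  assumes "finite (set_pmf p)" "finite (set_pmf q)"
  shows "measure_pmf.expectation (pair_pmf p q) h
    = measure_pmf.expectation q (\<lambda>y. measure_pmf.expectation p (\<lambda>x. h (x, y)))"
proof -
  have "measure_pmf.expectation (pair_pmf p q) h
      = (\<Sum>(x, y)\<in>set_pmf p \<times> set_pmf q. h (x, y) * pmf (pair_pmf p q) (x, y))"
    using assms by (subst integral_measure_pmf_real[where A = "set_pmf p \<times> set_pmf q"]) (auto simp: case_prod_beta)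
  also have "\<dots> = (\<Sum>y\<in>set_pmf q. \<Sum>x\<in>set_pmf p. h (x, y) * pmf p x * pmf q y)"
    by (subst sum.swap) (simp add: sum.cartesian_product pmf_pair mult.assoc)
  also have "\<dots> = (\<Sum>y\<in>set_pmf q. measure_pmf.expectation p (\<lambda>x. h (x, y)) * pmf q y)"
    using assms by (simp add: integral_measure_pmf_real[where A = "set_pmf p"] sum_distrib_right)
  also have "\<dots> = measure_pmf.expectation q (\<lambda>y. measure_pmf.expectation p (\<lambda>x. h (x, y)))"
    using assms by (simp add: integral_measure_pmf_real[where A = "set_pmf q"])
  finally show ?thesis .
qed

text \<open>The envelope is at least \<open>\<phi> xs\<close> everywhere, and the competitor
  \<open>xs\<close> bounds it above by \<open>\<phi> xs\<close> plus the quadratic. So its value at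
  \<open>xs\<close> is \<open>\<phi> xs\<close>.\<close>

lemma moreau_at_min:
  fixes \<phi> :: "'a::euclidean_space \<Rightarrow> real"
  assumes "continuous_on UNIV \<phi>" and min: "\<And>z. \<phi> xs \<le> \<phi> z" and "\<gamma> > 0"
  shows "moreau \<gamma> \<phi> xs \<le> moreau \<gamma> \<phi> y"
    and "moreau \<gamma> \<phi> y \<le> moreau \<gamma> \<phi> xs + 1 / \<gamma> / 2 * (norm (y - xs))\<^sup>2"
proof -
  have lower: "\<phi> xs \<le> moreau \<gamma> \<phi> y" for y
    using moreau_eq_prox[OF assms, of y] min[of "prox \<gamma> \<phi> y"] \<open>\<gamma> > 0\<close>
    by (simp add: add_increasing2)
  have upper: "moreau \<gamma> \<phi> y \<le> \<phi> xs + 1 / (2 * \<gamma>) * (norm (xs - y))\<^sup>2" for y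
    using moreau_le[of "\<phi> xs" \<phi> \<gamma> y xs, OF min \<open>\<gamma> > 0\<close>] .
  show "moreau \<gamma> \<phi> xs \<le> moreau \<gamma> \<phi> y"
    using upper[of xs] lower[of y] by simp
  show "moreau \<gamma> \<phi> y \<le> moreau \<gamma> \<phi> xs + 1 / \<gamma> / 2 * (norm (y - xs))\<^sup>2"
    using upper[of y] lower[of xs] by (simp add: norm_minus_commute mult.commute)
qed

subsection \<open>One step of the method\<close>

locale fedexprox_interpolation =
  fixes f :: "nat \<Rightarrow> 'a::euclidean_space \<Rightarrow> real"
    and n \<tau> :: nat and \<gamma> L\<gamma> :: real and xs :: 'a
  assumes n: "n \<ge> 2" and \<tau>: "\<tau> \<in> {1..n}" and \<gamma>: "\<gamma> > 0"
    and diff: "i \<in> {1..n} \<Longrightarrow> f i differentiable (at x)"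
    and convex: "i \<in> {1..n} \<Longrightarrow> convex_on UNIV (f i)"
    and grad_zero: "i \<in> {1..n} \<Longrightarrow> grad (f i) xs = 0"
    and smooth: "L_smooth L\<gamma> (avg_moreau n \<gamma> f)"
    and L\<gamma>: "L\<gamma> > 0"
begin

abbreviation M :: "'a \<Rightarrow> real" where
  "M \<equiv> avg_moreau n \<gamma> f"

abbreviation L :: real where
  "L \<equiv> L_nice n \<tau> \<gamma> L\<gamma>"

definition G :: "nat \<Rightarrow> 'a \<Rightarrow> 'a" where
  "G i x = (x - prox \<gamma> (f i) x) /\<^sub>R \<gamma>"

text \<open>This is the gradient of \<open>M\<close>, as the proof of
  \<open>avg_moreau_smooth\<close> shows.\<close>

definition avgG :: "'a \<Rightarrow> 'a" where
  "avgG x = (\<Sum>i\<in>{1..n}. G i x) /\<^sub>R real n"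

lemma continuous: "i \<in> {1..n} \<Longrightarrow> continuous_on UNIV (f i)"
  using diff by (intro continuous_at_imp_continuous_on) (auto intro: differentiable_imp_continuous_within)

lemma minimum: "i \<in> {1..n} \<Longrightarrow> f i xs \<le> f i z"
  using convex_grad_zero_imp_min diff convex grad_zero by blast

section \<open>Averaging the envelope inequalities over the indices\<close>

lemma average_mono:
  fixes h h' :: "nat \<Rightarrow> real"
  assumes "\<And>i. i \<in> {1..n} \<Longrightarrow> h i \<le> h' i"
  shows "1 / real n * (\<Sum>i\<in>{1..n}. h i) \<le> 1 / real n * (\<Sum>i\<in>{1..n}. h' i)"
  using assms by (intro mult_left_mono sum_mono) auto

lemma average_const: "1 / real n * (\<Sum>i\<in>{1..n}. c) = (c::real)"
  using n by simp

lemma average_inner: "1 / real n * (\<Sum>i\<in>{1..n}. G i x \<bullet> v) = avgG x \<bullet> v"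
  by (simp add: avgG_def inner_sum_left inverse_eq_divide)

lemma avg_moreau_subgradient: "M x + avgG x \<bullet> (y - x) \<le> M y"
proof -
  have "1 / real n * (\<Sum>i\<in>{1..n}. moreau \<gamma> (f i) x + G i x \<bullet> (y - x)) \<le> M y"
    unfolding avg_moreau_def G_def
    using moreau_subgradient[OF convex continuous minimum \<gamma>] by (intro average_mono) auto
  then show ?thesis
    by (simp only: sum.distrib distrib_left average_inner avg_moreau_def)
qed

lemma avg_moreau_majorant: "M y \<le> M x + avgG x \<bullet> (y - x) + 1 / (2 * \<gamma>) * (norm (y - x))\<^sup>2"
proof -
  have "M y \<le> 1 / real n * (\<Sum>i\<in>{1..n}. moreau \<gamma> (f i) x + G i x \<bullet> (y - x)
      + 1 / (2 * \<gamma>) * (norm (y - x))\<^sup>2)"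
    unfolding avg_moreau_def G_def
    using moreau_majorant[OF continuous minimum \<gamma>] by (intro average_mono) auto
  then show ?thesis
    by (simp only: sum.distrib distrib_left average_inner avg_moreau_def average_const)
qed

text \<open>\<open>L_smooth\<close> speaks of \<open>grad M\<close>. The majorant with constant
  \<open>1 / (2 * \<gamma>)\<close> identifies this gradient with \<open>avgG\<close>, and
  smoothness then supplies the constant \<open>L\<gamma>\<close>.\<close>

lemma avg_moreau_smooth: "M y \<le> M x + avgG x \<bullet> (y - x) + L\<gamma> / 2 * (norm (y - x))\<^sup>2"
proof -
  have "grad M x = avgG x"
    using smooth avg_moreau_majorant unfolding L_smooth_def
    by (intro grad_eq_of_quadratic_majorant[where c = "1 / (2 * \<gamma>)"]) auto
  moreover have "M y - M x - grad M x \<bullet> (y - x) \<le> L\<gamma> / 2 * (norm (y - x))\<^sup>2"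
    using smooth unfolding L_smooth_def by blast
  ultimately show ?thesis by simp
qed

lemma avg_moreau_min: "M xs \<le> M y"
  unfolding avg_moreau_def
  using moreau_at_min(1)[OF continuous minimum \<gamma>] by (intro average_mono) auto

lemma norm_G_le:
  assumes i: "i \<in> {1..n}"
  shows "(norm (G i x))\<^sup>2 \<le> 2 * (1 / \<gamma>) * (moreau \<gamma> (f i) x - moreau \<gamma> (f i) xs)"
proof (rule norm_gradient_le_gap)
  show "moreau \<gamma> (f i) y \<le> moreau \<gamma> (f i) x + G i x \<bullet> (y - x) + 1 / \<gamma> / 2 * (norm (y - x))\<^sup>2" for y
    using moreau_majorant[OF continuous[OF i] minimum[OF i] \<gamma>, of y x] by (simp add: G_def mult.commute)
  show "moreau \<gamma> (f i) xs \<le> moreau \<gamma> (f i) y" for y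
    using moreau_at_min(1)[OF continuous[OF i] minimum[OF i] \<gamma>] .
qed (use \<gamma> in simp)

lemma inner_G_ge:
  assumes i: "i \<in> {1..n}"
  shows "moreau \<gamma> (f i) x - moreau \<gamma> (f i) xs + (norm (G i x))\<^sup>2 / (2 * (1 / \<gamma>)) \<le> G i x \<bullet> (x - xs)"
proof (rule cocoercive_at_min)
  show "moreau \<gamma> (f i) y \<le> moreau \<gamma> (f i) xs + 1 / \<gamma> / 2 * (norm (y - xs))\<^sup>2" for y
    using moreau_at_min(2)[OF continuous[OF i] minimum[OF i] \<gamma>] .
  show "moreau \<gamma> (f i) x + G i x \<bullet> (y - x) \<le> moreau \<gamma> (f i) y" for y
    using moreau_subgradient[OF convex[OF i] continuous[OF i] minimum[OF i] \<gamma>] by (simp add: G_def)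
qed (use \<gamma> in simp)

lemma avg_norm_G_le:
  "1 / real n * (\<Sum>i\<in>{1..n}. (norm (G i x))\<^sup>2) \<le> 2 / \<gamma> * (M x - M xs)"
proof -
  have "1 / real n * (\<Sum>i\<in>{1..n}. (norm (G i x))\<^sup>2)
      \<le> 1 / real n * (\<Sum>i\<in>{1..n}. 2 * (1 / \<gamma>) * (moreau \<gamma> (f i) x - moreau \<gamma> (f i) xs))"
    using norm_G_le by (rule average_mono)
  also have "\<dots> = 2 / \<gamma> * (M x - M xs)"
    unfolding avg_moreau_def sum_distrib_left[symmetric] sum_subtractf
    by (simp add: diff_divide_distrib right_diff_distrib mult.commute)
  finally show ?thesis .
qed

lemma avg_inner_G_ge:
  "M x - M xs + \<gamma> / 2 * (1 / real n * (\<Sum>i\<in>{1..n}. (norm (G i x))\<^sup>2)) \<le> avgG x \<bullet> (x - xs)"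
proof -
  have "M x - M xs + \<gamma> / 2 * (1 / real n * (\<Sum>i\<in>{1..n}. (norm (G i x))\<^sup>2))
      = 1 / real n * (\<Sum>i\<in>{1..n}. moreau \<gamma> (f i) x - moreau \<gamma> (f i) xs
          + (norm (G i x))\<^sup>2 / (2 * (1 / \<gamma>)))"
    unfolding avg_moreau_def sum.distrib sum_subtractf sum_divide_distrib[symmetric]
    by (simp add: add_divide_distrib diff_divide_distrib)
  also have "\<dots> \<le> 1 / real n * (\<Sum>i\<in>{1..n}. G i x \<bullet> (x - xs))"
    using inner_G_ge by (rule average_mono)
  finally show ?thesis
    by (simp only: average_inner)
qed

lemma norm_avgG_le: "(norm (avgG x))\<^sup>2 \<le> 2 * L\<gamma> * (M x - M xs)"
  using L\<gamma> avg_moreau_smooth avg_moreau_min by (rule norm_gradient_le_gap)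

lemma avgG_at_min: "avgG xs = 0"
proof -
  have "(norm (avgG xs))\<^sup>2 \<le> 0"
    using norm_avgG_le[of xs] by simp
  then show ?thesis by simp
qed

lemma inner_avgG_ge: "M x - M xs + (norm (avgG x))\<^sup>2 / (2 * L\<gamma>) \<le> avgG x \<bullet> (x - xs)"
proof (rule cocoercive_at_min[OF L\<gamma> _ avg_moreau_subgradient])
  show "M y \<le> M xs + L\<gamma> / 2 * (norm (y - xs))\<^sup>2" for y
    using avg_moreau_smooth[of y xs] by (simp add: avgG_at_min)
qed

section \<open>The sampling weights and the second moment of the sampled gradient\<close>

definition a :: real where
  "a = (real n - real \<tau>) / (real \<tau> * (real n - 1))"

definition b :: real where
  "b = real n * (real \<tau> - 1) / (real \<tau> * (real n - 1))"

lemma L_eq: "L = a * (1 / \<gamma>) + b * L\<gamma>"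
  by (simp add: L_nice_def a_def b_def)

lemma a_nonneg: "a \<ge> 0" and b_nonneg: "b \<ge> 0"
  using n \<tau> by (auto simp: a_def b_def)

lemma a_plus_b: "a + b = 1"
proof -
  have "a + b = (real n - real \<tau> + real n * (real \<tau> - 1)) / (real \<tau> * (real n - 1))"
    by (simp add: a_def b_def add_divide_distrib)
  also have "real n - real \<tau> + real n * (real \<tau> - 1) = real \<tau> * (real n - 1)"
    by (simp add: algebra_simps)
  finally show ?thesis
    using n \<tau> by simp
qed

lemma L_pos: "L > 0"
\<comment> \<open>Under full sampling, \<open>\<tau> = n\<close>, the weight \<open>a\<close>
  vanishes and \<open>b = 1\<close>, so positivity comes from \<open>L\<gamma>\<close>.\<close>
proof (cases "a = 0")
  case True
  then show ?thesis
    using a_plus_b L\<gamma> by (simp add: L_eq)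
next
  case False
  then have "a * (1 / \<gamma>) > 0"
    using a_nonneg \<gamma> by simp
  then show ?thesis
    using b_nonneg L\<gamma> by (simp add: L_eq add_pos_nonneg)
qed

definition V :: "'a \<Rightarrow> real" where
  "V x = a * (1 / real n * (\<Sum>i\<in>{1..n}. (norm (G i x))\<^sup>2)) + b * (norm (avgG x))\<^sup>2"

lemma V_nonneg: "V x \<ge> 0"
  unfolding V_def using a_nonneg b_nonneg by (intro add_nonneg_nonneg mult_nonneg_nonneg sum_nonneg) auto

lemma V_le: "V x \<le> 2 * L * (M x - M xs)"
proof -
  have "V x \<le> a * (2 / \<gamma> * (M x - M xs)) + b * (2 * L\<gamma> * (M x - M xs))"
    unfolding V_def
    by (intro add_mono mult_left_mono avg_norm_G_le norm_avgG_le a_nonneg b_nonneg)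
  then show ?thesis
    by (simp add: L_eq algebra_simps)
qed

lemma inner_avgG_ge_V: "M x - M xs + V x / (2 * L) \<le> avgG x \<bullet> (x - xs)"
proof -
  let ?A = "1 / real n * (\<Sum>i\<in>{1..n}. (norm (G i x))\<^sup>2)"
  \<comment> \<open>The weights cancel the denominators in the two cocoercivity bounds, so the
    squared norms add up to \<open>V x / 2\<close>.\<close>
  have "a * (1 / \<gamma>) * (M x - M xs + \<gamma> / 2 * ?A)
        + b * L\<gamma> * (M x - M xs + (norm (avgG x))\<^sup>2 / (2 * L\<gamma>))
      \<le> a * (1 / \<gamma>) * (avgG x \<bullet> (x - xs)) + b * L\<gamma> * (avgG x \<bullet> (x - xs))"
    using a_nonneg b_nonneg \<gamma> L\<gamma>
    by (intro add_mono mult_left_mono avg_inner_G_ge inner_avgG_ge mult_nonneg_nonneg) auto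
  also have "\<dots> = L * (avgG x \<bullet> (x - xs))"
    by (simp add: L_eq algebra_simps)
  also have "a * (1 / \<gamma>) * (M x - M xs + \<gamma> / 2 * ?A)
        + b * L\<gamma> * (M x - M xs + (norm (avgG x))\<^sup>2 / (2 * L\<gamma>)) = L * (M x - M xs) + V x / 2"
    unfolding L_eq V_def distrib_left distrib_right using \<gamma> L\<gamma> by simp
  also have "\<dots> = L * (M x - M xs + V x / (2 * L))"
    using L_pos by (simp add: distrib_left)
  finally show ?thesis
    using L_pos by simp
qed

text \<open>The update subtracts \<open>c\<close> times the sum of the sampled \<open>G i x\<close>;
  expanding the square leaves the first and second moment of that sum.\<close>

lemma expectation_step:
  "measure_pmf.expectation (nice_sampling n \<tau>)
     (\<lambda>A. (norm (x + \<alpha> *\<^sub>R ((1 / real \<tau>) *\<^sub>R (\<Sum>i\<in>A. prox \<gamma> (f i) x) - x) - xs))\<^sup>2)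
   = (norm (x - xs))\<^sup>2 - 2 * (\<alpha> * \<gamma>) * (avgG x \<bullet> (x - xs)) + (\<alpha> * \<gamma>)\<^sup>2 * V x"
proof -
  define c where "c = \<alpha> * \<gamma> / real \<tau>"
  have c: "real \<tau> * c = \<alpha> * \<gamma>"
    using \<tau> by (simp add: c_def)
  have "(norm (x + \<alpha> *\<^sub>R ((1 / real \<tau>) *\<^sub>R (\<Sum>i\<in>A. prox \<gamma> (f i) x) - x) - xs))\<^sup>2
      = (norm (x - xs))\<^sup>2 - 2 * c * (\<Sum>i\<in>A. G i x \<bullet> (x - xs)) + c\<^sup>2 * (norm (\<Sum>i\<in>A. G i x))\<^sup>2"
    if A: "card A = \<tau>" for A
  proof -
    \<comment> \<open>Since \<open>card A = \<tau>\<close>, the copies of \<open>x\<close> add up to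
      \<open>\<tau>\<close> times \<open>x\<close>, which turns the averaged prox step into a
      gradient step.\<close>
    have "(\<Sum>i\<in>A. G i x) = (real \<tau> *\<^sub>R x - (\<Sum>i\<in>A. prox \<gamma> (f i) x)) /\<^sub>R \<gamma>"
      by (simp add: G_def sum_subtractf A scaleR_diff_right scaleR_sum_right sum_constant_scaleR)
    then have "c *\<^sub>R (\<Sum>i\<in>A. G i x) = \<alpha> *\<^sub>R (x - (1 / real \<tau>) *\<^sub>R (\<Sum>i\<in>A. prox \<gamma> (f i) x))"
      using \<gamma> \<tau> by (simp add: c_def scaleR_diff_right)
    then have "x + \<alpha> *\<^sub>R ((1 / real \<tau>) *\<^sub>R (\<Sum>i\<in>A. prox \<gamma> (f i) x) - x) - xs
        = (x - xs) - c *\<^sub>R (\<Sum>i\<in>A. G i x)"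
      by (simp add: scaleR_diff_right)
    moreover have "(norm (u - c *\<^sub>R w))\<^sup>2 = (norm u)\<^sup>2 - 2 * c * (w \<bullet> u) + c\<^sup>2 * (norm w)\<^sup>2" for u w :: 'a
      unfolding power2_norm_eq_inner by (simp add: power2_eq_square algebra_simps inner_commute)
    ultimately show ?thesis
      by (simp only: inner_sum_left)
  qed
  then have "measure_pmf.expectation (nice_sampling n \<tau>)
      (\<lambda>A. (norm (x + \<alpha> *\<^sub>R ((1 / real \<tau>) *\<^sub>R (\<Sum>i\<in>A. prox \<gamma> (f i) x) - x) - xs))\<^sup>2)
    = measure_pmf.expectation (nice_sampling n \<tau>)
      (\<lambda>A. (norm (x - xs))\<^sup>2 - 2 * c * (\<Sum>i\<in>A. G i x \<bullet> (x - xs)) + c\<^sup>2 * (norm (\<Sum>i\<in>A. G i x))\<^sup>2)"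
    by (intro integral_cong_AE) (auto simp: AE_measure_pmf_iff set_nice_sampling[OF \<tau>])
  also have "\<dots> = (norm (x - xs))\<^sup>2
      - 2 * c * measure_pmf.expectation (nice_sampling n \<tau>) (\<lambda>A. \<Sum>i\<in>A. G i x \<bullet> (x - xs))
      + c\<^sup>2 * measure_pmf.expectation (nice_sampling n \<tau>) (\<lambda>A. (norm (\<Sum>i\<in>A. G i x))\<^sup>2)"
    by (simp add: integrable_nice_sampling[OF \<tau>])
  also have "measure_pmf.expectation (nice_sampling n \<tau>) (\<lambda>A. \<Sum>i\<in>A. G i x \<bullet> (x - xs))
      = real \<tau> * (avgG x \<bullet> (x - xs))"
    unfolding expectation_nice_sum[OF \<tau>] average_inner[symmetric] by simp
  also have "measure_pmf.expectation (nice_sampling n \<tau>) (\<lambda>A. (norm (\<Sum>i\<in>A. G i x))\<^sup>2) = (real \<tau>)\<^sup>2 * V x"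
  proof -
    \<comment> \<open>Passing from sums to averages turns the sampling coefficients into
      \<open>\<tau>\<close> squared times \<open>a\<close> and \<open>b\<close>.\<close>
    have "(norm (\<Sum>i\<in>{1..n}. G i x))\<^sup>2 = (real n)\<^sup>2 * (norm (avgG x))\<^sup>2"
      using n by (simp add: avgG_def power_mult_distrib field_simps)
    moreover have "real \<tau> * (real n - real \<tau>) / (real n * (real n - 1)) * z = (real \<tau>)\<^sup>2 * (a * (1 / real n * z))" for z
      using \<tau> by (simp add: a_def power2_eq_square mult_ac)
    moreover have "real \<tau> * (real \<tau> - 1) / (real n * (real n - 1)) * ((real n)\<^sup>2 * z)
        = (real \<tau>)\<^sup>2 * (b * z)" for z
      using \<tau> by (simp add: b_def power2_eq_square mult_ac)
    ultimately show ?thesis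
      unfolding expectation_nice_norm_sum[OF \<tau> n] V_def by (simp only: distrib_left)
  qed
  also have "2 * c * (real \<tau> * (avgG x \<bullet> (x - xs))) = 2 * (\<alpha> * \<gamma>) * (avgG x \<bullet> (x - xs))"
    by (simp flip: c)
  also have "c\<^sup>2 * ((real \<tau>)\<^sup>2 * V x) = (\<alpha> * \<gamma>)\<^sup>2 * V x"
    by (simp add: power_mult_distrib flip: c)
  finally show ?thesis .
qed

lemma expectation_step_le:
  assumes "0 < \<alpha>" "\<alpha> < 2 / (\<gamma> * L)"
  shows "measure_pmf.expectation (nice_sampling n \<tau>)
     (\<lambda>A. (norm (x + \<alpha> *\<^sub>R ((1 / real \<tau>) *\<^sub>R (\<Sum>i\<in>A. prox \<gamma> (f i) x) - x) - xs))\<^sup>2)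
   \<le> (norm (x - xs))\<^sup>2 - \<alpha> * (2 - \<alpha> * \<gamma> * L) * (\<gamma> * M x - \<gamma> * M xs)"
proof -
  define D W t where "D = M x - M xs" and "W = V x / L" and "t = \<alpha> * \<gamma> * L"
  have t: "0 < t" "t < 2"
    using assms \<gamma> L_pos by (simp_all add: t_def field_simps)
  have W: "0 \<le> W" "W \<le> 2 * D"
    using V_nonneg[of x] V_le[of x] L_pos by (simp_all add: W_def D_def field_simps)
  \<comment> \<open>The claim reduces to this bound. It is affine in \<open>W\<close>, which ranges
    over \<open>[0, 2 * D]\<close>, and the end values \<open>t * D\<close> and
    \<open>(2 - t) * D\<close> are nonnegative.\<close>
  have "0 \<le> t * D + (1 - t) * W"
  proof (cases "t \<le> 1")
    case True
    then show ?thesis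
      using t W by simp
  next
    case False
    then have "(t - 1) * W \<le> (t - 1) * (2 * D)"
      using W by (intro mult_left_mono) auto
    moreover have "0 \<le> (2 - t) * D"
      using t W by simp
    ultimately show ?thesis
      by (simp add: algebra_simps)
  qed
  then have "(2 - t) * D \<le> 2 * (D + W / 2) - t * W"
    by (simp add: algebra_simps)
  also have "\<dots> \<le> 2 * (avgG x \<bullet> (x - xs)) - t * W"
    using inner_avgG_ge_V[of x] by (simp add: D_def W_def)
  finally have "\<alpha> * \<gamma> * ((2 - t) * D) \<le> \<alpha> * \<gamma> * (2 * (avgG x \<bullet> (x - xs)) - t * W)"
    using assms \<gamma> by (intro mult_left_mono) auto
  moreover have "V x = L * W"
    using L_pos by (simp add: W_def)
  ultimately show ?thesis
    unfolding expectation_step by (simp add: t_def D_def algebra_simps power2_eq_square)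
qed

end

subsection \<open>Independence along the iterations\<close>

text \<open>Iterate \<open>k\<close> does not see \<open>S k\<close>; this is the source of
  independence in \<open>expected_gap_le\<close>.\<close>

lemma fedexprox_cong:
  "(\<And>j. j < k \<Longrightarrow> S j = S' j) \<Longrightarrow> fedexprox \<tau> \<gamma> f \<alpha> x0 S k = fedexprox \<tau> \<gamma> f \<alpha> x0 S' k"
  by (induction k) (simp_all add: Let_def)

lemma finite_set_Pi_pmf:
  assumes "finite A" "\<And>x. x \<in> A \<Longrightarrow> finite (set_pmf (p x))"
  shows "finite (set_pmf (Pi_pmf A dflt p))"
  using assms by (simp add: set_Pi_pmf finite_PiE_dflt)

text \<open>The condition on \<open>Y\<close> says that it ignores coordinate \<open>k\<close>,
  hence is independent of it, so this coordinate can be integrated first with \<open>Y S\<close>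
  held fixed.\<close>

lemma expectation_Pi_pmf_fresh:
  fixes F :: "'b \<Rightarrow> 'c \<Rightarrow> real" and Y :: "('i \<Rightarrow> 'c) \<Rightarrow> 'b"
  assumes "finite I" "k \<in> I" and fin: "\<And>i. i \<in> I \<Longrightarrow> finite (set_pmf (p i))"
    and Y: "\<And>S y. Y (S(k := y)) = Y S"
  shows "measure_pmf.expectation (Pi_pmf I d p) (\<lambda>S. F (Y S) (S k))
    = measure_pmf.expectation (Pi_pmf I d p) (\<lambda>S. measure_pmf.expectation (p k) (F (Y S)))"
proof -
  let ?P = "Pi_pmf (I - {k}) d p"
  \<comment> \<open>Drawing the other coordinates and then coordinate \<open>k\<close> independently
    reproduces the product law.\<close>
  have P: "Pi_pmf I d p = map_pmf (\<lambda>(y, S). S(k := y)) (pair_pmf (p k) ?P)"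
    using Pi_pmf_insert[of "I - {k}" k d p] assms(1,2) by (simp add: insert_absorb)
  have "finite (set_pmf (p k))" "finite (set_pmf ?P)"
    using assms by (auto intro: finite_set_Pi_pmf)
  then show ?thesis
    unfolding P by (simp add: expectation_pair_pmf_finite case_prod_beta Y)
qed

lemma expectation_fedexprox_avg:
  assumes "\<tau> \<in> {1..n}" "K \<ge> 1"
  shows "measure_pmf.expectation (fedexprox_avg n \<tau> \<gamma> f \<alpha> x0 K) h
    = (\<Sum>k<K. measure_pmf.expectation (Pi_pmf {..<K} {} (\<lambda>_. nice_sampling n \<tau>))
          (\<lambda>S. h (fedexprox \<tau> \<gamma> f \<alpha> x0 S k))) / real K"
proof -
  let ?P = "Pi_pmf {..<K} {} (\<lambda>_. nice_sampling n \<tau>)"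
  have K: "{..<K} \<noteq> {}"
    using assms(2) by (simp add: lessThan_empty_iff)
  have fin: "finite (set_pmf ?P)"
    by (intro finite_set_Pi_pmf) (auto simp: set_nice_sampling[OF assms(1)])
  have int: "integrable (measure_pmf ?P) u" for u :: "_ \<Rightarrow> real"
    using fin by (rule integrable_measure_pmf_finite)
  have "measure_pmf.expectation (fedexprox_avg n \<tau> \<gamma> f \<alpha> x0 K) h
      = measure_pmf.expectation ?P (\<lambda>S. (\<Sum>k<K. h (fedexprox \<tau> \<gamma> f \<alpha> x0 S k)) / real K)"
    unfolding fedexprox_avg_def using K fin
    by (simp add: expectation_pair_pmf_finite case_prod_beta integral_pmf_of_set)
  also have "\<dots> = (\<Sum>k<K. measure_pmf.expectation ?P (\<lambda>S. h (fedexprox \<tau> \<gamma> f \<alpha> x0 S k))) / real K"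
    by (simp add: int)
  finally show ?thesis .
qed

section \<open>Telescoping the expected decrease\<close>

context fedexprox_interpolation
begin

lemma expected_gap_le:
  assumes \<alpha>: "0 < \<alpha>" "\<alpha> < 2 / (\<gamma> * L)" and K: "K \<ge> 1"
  shows "measure_pmf.expectation (fedexprox_avg n \<tau> \<gamma> f (\<lambda>_. \<alpha>) x0 K) (\<lambda>x. \<gamma> * M x) - \<gamma> * M xs
    \<le> 1 / (\<alpha> * (2 - \<alpha> * \<gamma> * L)) * ((norm (x0 - xs))\<^sup>2 / real K)"
proof -
  define P where "P = Pi_pmf {..<K} {} (\<lambda>_. nice_sampling n \<tau>)"
  define Y where "Y k S = fedexprox \<tau> \<gamma> f (\<lambda>_. \<alpha>) x0 S k" for k S
  define c where "c = \<alpha> * (2 - \<alpha> * \<gamma> * L)"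
  define D where "D k = measure_pmf.expectation P (\<lambda>S. \<gamma> * M (Y k S))" for k
  define W where "W k = measure_pmf.expectation P (\<lambda>S. (norm (Y k S - xs))\<^sup>2)" for k
  have c: "c > 0"
    using \<alpha> \<gamma> L_pos by (simp add: c_def field_simps)
  have fin: "finite (set_pmf P)"
    unfolding P_def by (intro finite_set_Pi_pmf) (auto simp: set_nice_sampling[OF \<tau>])
  have int: "integrable (measure_pmf P) u" for u :: "_ \<Rightarrow> real"
    using fin by (rule integrable_measure_pmf_finite)
  \<comment> \<open>\<open>S k\<close> is independent of iterate \<open>k\<close>, so the one-step
    bound applies under the expectation with the iterate held fixed.\<close>
  have step: "W (Suc k) \<le> W k - c * (D k - \<gamma> * M xs)" if "k < K" for k
  proof -
    let ?F = "\<lambda>x A. (norm (x + \<alpha> *\<^sub>R ((1 / real \<tau>) *\<^sub>R (\<Sum>i\<in>A. prox \<gamma> (f i) x) - x) - xs))\<^sup>2"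
    have "W (Suc k) = measure_pmf.expectation P (\<lambda>S. ?F (Y k S) (S k))"
      by (simp add: W_def Y_def Let_def)
    also have "\<dots> = measure_pmf.expectation P
        (\<lambda>S. measure_pmf.expectation (nice_sampling n \<tau>) (?F (Y k S)))"
      unfolding P_def using that
      by (intro expectation_Pi_pmf_fresh)
        (auto simp: set_nice_sampling[OF \<tau>] Y_def intro!: fedexprox_cong)
    also have "\<dots> \<le> measure_pmf.expectation P
        (\<lambda>S. (norm (Y k S - xs))\<^sup>2 - c * (\<gamma> * M (Y k S) - \<gamma> * M xs))"
      unfolding c_def by (intro integral_mono int expectation_step_le \<alpha>)
    also have "\<dots> = W k - c * (D k - \<gamma> * M xs)"
      by (simp add: W_def D_def int)
    finally show ?thesis .
  qed
  \<comment> \<open>The distances telescope and end one index past the last gap, so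
    \<open>m = K\<close> uses only steps with \<open>k < K\<close>.\<close>
  have "c * (\<Sum>k<m. D k - \<gamma> * M xs) \<le> W 0 - W m" if "m \<le> K" for m
    using that
  proof (induction m)
    case (Suc m)
    then show ?case
      using step[of m] by (simp add: distrib_left)
  qed simp
  from this[of K] have "c * ((\<Sum>k<K. D k) - real K * (\<gamma> * M xs)) \<le> W 0 - W K"
    by (simp add: sum_subtractf)
  \<comment> \<open>The start is deterministic, and the nonnegative \<open>W K\<close> is
    dropped.\<close>
  also have "\<dots> \<le> (norm (x0 - xs))\<^sup>2"
    by (simp add: W_def Y_def)
  finally have "(\<Sum>k<K. D k) - real K * (\<gamma> * M xs) \<le> (norm (x0 - xs))\<^sup>2 / c"
    using c by (simp add: pos_le_divide_eq mult.commute)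
  then have "((\<Sum>k<K. D k) - real K * (\<gamma> * M xs)) / real K \<le> (norm (x0 - xs))\<^sup>2 / c / real K"
    by (rule divide_right_mono) simp
  then have "(\<Sum>k<K. D k) / real K - \<gamma> * M xs \<le> 1 / c * ((norm (x0 - xs))\<^sup>2 / real K)"
    using K by (simp add: diff_divide_distrib)
  then show ?thesis
    unfolding expectation_fedexprox_avg[OF \<tau> K] c_def D_def Y_def P_def .
qed

lemma Inf_avg_moreau: "(INF x. \<gamma> * M x) = \<gamma> * M xs"
  using avg_moreau_min \<gamma> by (intro cInf_eq_minimum) auto

end

section \<open>Convergence rate and the optimal extrapolation parameter\<close>

theorem theorem4:
  fixes f :: "nat \<Rightarrow> 'a::euclidean_space \<Rightarrow> real"
    and n \<tau> K :: nat
    and \<gamma> L\<gamma> :: real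
    and x0 xs :: 'a
  defines "M \<equiv> avg_moreau n \<gamma> f"
    and "L \<equiv> L_nice n \<tau> \<gamma> L\<gamma>"
    and "rhs \<equiv> (\<lambda>\<alpha>. 1 / (\<alpha> * (2 - \<alpha> * \<gamma> * L_nice n \<tau> \<gamma> L\<gamma>)) * ((norm (x0 - xs))\<^sup>2 / real K))"
    and "gap \<equiv> (\<lambda>\<alpha>. measure_pmf.expectation (fedexprox_avg n \<tau> \<gamma> f (\<lambda>_. \<alpha>) x0 K)
                        (\<lambda>x. \<gamma> * avg_moreau n \<gamma> f x)
                     - (INF x. \<gamma> * avg_moreau n \<gamma> f x))"
  assumes "n \<ge> 2" and "\<tau> \<in> {1..n}" and "K \<ge> 1" and "\<gamma> > 0"
    and "\<And>i x. i \<in> {1..n} \<Longrightarrow> f i differentiable (at x)"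
    and "\<And>i. i \<in> {1..n} \<Longrightarrow> convex_on UNIV (f i)"
    and "\<And>i. i \<in> {1..n} \<Longrightarrow> grad (f i) xs = 0"
    and "L_smooth L\<gamma> M" and "L\<gamma> > 0" and "L\<gamma> \<le> 1 / \<gamma>"
  shows "(\<forall>\<alpha>. 0 < \<alpha> \<and> \<alpha> < 2 / (\<gamma> * L) \<longrightarrow> gap \<alpha> \<le> rhs \<alpha>)
    \<and> is_arg_min rhs (\<lambda>\<alpha>. 0 < \<alpha> \<and> \<alpha> < 2 / (\<gamma> * L)) (1 / (\<gamma> * L))
    \<and> (x0 \<noteq> xs \<longrightarrow> (\<forall>\<alpha>. is_arg_min rhs (\<lambda>\<alpha>. 0 < \<alpha> \<and> \<alpha> < 2 / (\<gamma> * L)) \<alpha> \<longrightarrow> \<alpha> = 1 / (\<gamma> * L)))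
    \<and> 1 / (\<gamma> * L) \<ge> 1
    \<and> gap (1 / (\<gamma> * L)) \<le>
        ((real n - real \<tau>) / (real \<tau> * (real n - 1))
         + real n * (real \<tau> - 1) / (real \<tau> * (real n - 1)) * \<gamma> * L\<gamma>)
        * ((norm (x0 - xs))\<^sup>2 / real K)"
proof -
  interpret I: fedexprox_interpolation f n \<tau> \<gamma> L\<gamma> xs
    using assms by unfold_locales (auto simp: M_def)
  define s where "s = \<gamma> * L"
  define N where "N = (norm (x0 - xs))\<^sup>2 / real K"
  have s: "s > 0"
    using I.L_pos I.\<gamma> by (simp add: s_def L_def)
  have s_eq: "s = I.a + I.b * \<gamma> * L\<gamma>"
    using I.L_eq I.\<gamma> by (simp add: s_def L_def distrib_left)
  \<comment> \<open>Here \<open>L\<gamma> \<le> 1 / \<gamma>\<close> enters: together with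
    \<open>a + b = 1\<close> it gives \<open>s \<le> 1\<close>, so the optimal parameter is at least
    1.\<close>
  have "I.b * (\<gamma> * L\<gamma>) \<le> I.b * 1"
    using \<open>L\<gamma> \<le> 1 / \<gamma>\<close> I.\<gamma> I.b_nonneg by (intro mult_left_mono) (simp_all add: field_simps)
  then have s_le: "s \<le> 1"
    using I.a_plus_b by (simp add: s_eq mult.assoc)
  have N: "N \<ge> 0"
    by (simp add: N_def)
  have rhs: "rhs \<alpha> = 1 / (\<alpha> * (2 - \<alpha> * s)) * N" for \<alpha>
    by (simp add: rhs_def s_def L_def N_def mult.assoc)
  have rhs_opt: "rhs (1 / s) = s * N"
    using s by (simp add: rhs)
  \<comment> \<open>The infimum in \<open>gap\<close> is attained at \<open>xs\<close>.\<close>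
  have gap: "gap \<alpha> \<le> rhs \<alpha>" if "0 < \<alpha>" "\<alpha> < 2 / s" for \<alpha>
    unfolding gap_def rhs_def I.Inf_avg_moreau
    using that \<open>K \<ge> 1\<close> by (intro I.expected_gap_le) (simp_all add: s_def L_def)
  \<comment> \<open>Completing the square: \<open>\<alpha> * (2 - \<alpha> * s)\<close> is at most
    \<open>1 / s\<close>, with equality exactly at \<open>\<alpha> = 1 / s\<close>.\<close>
  have denom: "s * (\<alpha> * (2 - \<alpha> * s)) = 1 - (\<alpha> * s - 1)\<^sup>2" for \<alpha>
    by (simp add: power2_eq_square algebra_simps)
  have denom_pos: "0 < \<alpha> * (2 - \<alpha> * s)" if "0 < \<alpha>" "\<alpha> < 2 / s" for \<alpha>
    using that s by (simp add: field_simps)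
  have le: "s \<le> 1 / (\<alpha> * (2 - \<alpha> * s))" if "0 < \<alpha>" "\<alpha> < 2 / s" for \<alpha>
    using denom[of \<alpha>] denom_pos[OF that] by (simp add: pos_le_divide_eq)
  have opt: "1 / s < 2 / s" "0 < 1 / s"
    using s by (simp_all add: divide_strict_right_mono)
  have min: "rhs (1 / s) \<le> rhs \<alpha>" if "0 < \<alpha>" "\<alpha> < 2 / s" for \<alpha>
    unfolding rhs_opt unfolding rhs using le[OF that] N by (rule mult_right_mono)
  have uniq: "\<alpha> = 1 / s" if "0 < \<alpha>" "\<alpha> < 2 / s" "rhs \<alpha> \<le> rhs (1 / s)" "x0 \<noteq> xs" for \<alpha>
  proof -
    \<comment> \<open>Distinct points make the factor \<open>N\<close> positive, so it cancels; for
      \<open>x0 = xs\<close> the bound \<open>rhs\<close> is identically 0 and its minimizer is not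
      unique.\<close>
    have "N > 0"
      using that(4) \<open>K \<ge> 1\<close> by (simp add: N_def)
    then have "1 / (\<alpha> * (2 - \<alpha> * s)) \<le> s"
      using that(3) unfolding rhs_opt unfolding rhs by (simp only: mult_le_cancel_right_pos)
    then have "1 \<le> s * (\<alpha> * (2 - \<alpha> * s))"
      using denom_pos[OF that(1,2)] by (simp add: pos_divide_le_eq)
    then have "(\<alpha> * s - 1)\<^sup>2 \<le> 0"
      by (simp add: denom)
    then show ?thesis
      using s by (simp add: field_simps)
  qed
  have "is_arg_min rhs (\<lambda>\<alpha>. 0 < \<alpha> \<and> \<alpha> < 2 / s) (1 / s)"
    unfolding is_arg_min_linorder using opt min by blast
  moreover have "\<alpha> = 1 / s" if "x0 \<noteq> xs" "is_arg_min rhs (\<lambda>\<alpha>. 0 < \<alpha> \<and> \<alpha> < 2 / s) \<alpha>" for \<alpha>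
    using that opt unfolding is_arg_min_linorder by (intro uniq) auto
  moreover have "gap (1 / s) \<le> s * N"
    using gap[of "1 / s"] opt rhs_opt by simp
  moreover have "1 / s \<ge> 1"
    using s s_le by simp
  ultimately show ?thesis
    using gap unfolding s_def[symmetric] N_def[symmetric] I.a_def[symmetric] I.b_def[symmetric]
      s_eq[symmetric] by blast
qed

end
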